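(* Let $(\Gamma,\alpha)$ be a $3$-valent orientable $T^2$-GKM graph and $T=T^2$. Then the total equivariant Stiefel--Whitney class of $(\Gamma,\alpha)$ lies in the image of the map $$\Psi\colon H_T^*(\Gamma;\mathbb{Z})\to H_T^*(\Gamma;\mathbb{Z}_2)\oplus B^*(\Gamma,2),\qquad \Psi((f_v))=\left((r(f_v))_v,\ \left(r\left(\frac{f_{i(e)}-f_{t(e)}}{\alpha(e)}\right)\right)_{e\in E(\Gamma,2)}\right).$$
   Context: Let $T=T^2=S^1\times S^1$, $H^2(BT;\mathbb{Z})\cong\mathbb{Z}^2$, $\mathbb{Z}_2=\mathbb{Z}/2$, and let $r$ denote reduction of coefficients from $\mathbb{Z}$ to $\mathbb{Z}_2$. Abstract GKM graphs: let $\Gamma$ be an $n$-valent graph with finite vertex set and finite edge set $E(\Gamma)$, without loops but possibly with multiple edges. For an oriented edge $e$, $i(e),t(e)$ are its initial and terminal vertices, $\bar e$ the reversed edge, and $E_v$ is the set of oriented edges with initial vertex $v$. A connection is a collection of bijections $\nabla_e\colon E_{i(e)}\to E_{t(e)}$, one for each oriented edge, with $\nabla_e(e)=\bar e$ and $\nabla_{\bar e}=\nabla_e^{-1}$. A $T^2$-GKM graph is such a $\Gamma$ with a labelling $\alpha\colon E(\Gamma)\to\mathbb{Z}^2/\pm1$ of the (unoriented) edges such that (i) for each vertex $v$ and $e\ne f\in E_v$ the labels $\alpha(e),\alpha(f)$ are linearly independent, and (ii) there exists a compatible connection $\nabla$, i.e. for every oriented edge $e$ and $f\in E_{i(e)}$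 there are sign choices with $\alpha(\nabla_ef)\equiv\alpha(f)\bmod\alpha(e)$. Orientability: choose a compatible connection $\nabla$ and a lift $\tilde\alpha\colon E(\Gamma)\to\mathbb{Z}^2$ of $\alpha$. For an oriented edge $e$ and $e\neq f\in E_{i(e)}$ let $\epsilon_f\in\{\pm1\}$ be the unique sign with $\tilde\alpha(f)\equiv\epsilon_f\tilde\alpha(\nabla_ef)\bmod\alpha(e)$, and set $\eta(e)=-\prod_{f\in E_{i(e)}\setminus\{e\}}\epsilon_f$. $(\Gamma,\alpha)$ is orientable if $\eta(e_1)\cdots\eta(e_l)=1$ for every closed edge path $e_1,\dots,e_l$; this does not depend on the choices of $\nabla,\tilde\alpha$. For $A=\mathbb{Z},\mathbb{Z}_2$: $H_T^*(\Gamma;A)=\{(f_v)\in\bigoplus_vH^*(BT;A)\mid f_v\equiv f_w\bmod\alpha(e)\text{ for every edge } e\text{ between } v,w\}$. $E(\Gamma,2)=\{e\mid\alpha(e)\equiv0\bmod2\}$ and $B^*(\Gamma,2)=\bigoplus_{e\in E(\Gamma,2)}H^{*-2}(BT;\mathbb{Z}_2)$. In the definition of $\Psi$ an orientation of each edge and a sign of each label are chosen; mod $2$ the result does not depend on this choice. The total equivariant Stiefel--Whitney class of $(\Gamma,\alpha)$ is the element $((f_v)_v,(f_e)_{e\in E(\Gamma,2)})\in H_T^*(\Gamma;\mathbb{Z}_2)\oplus B^*(\Gamma,2)$ with $$f_v=\prod_{l\in E_v}(1+r(\alpha(l))),\qquad f_e=r\left(\frac{\prod_{l\in E_{i(e)}}(1+\tilde\alpha(l))-\prod_{l\in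 E_{t(e)}}(1+\tilde\alpha(l))}{\tilde\alpha(e)}\right),$$ where for $e\in E(\Gamma,2)$ one chooses a compatible connection $\nabla$ and lifts $\tilde\alpha(-)\in H^2(BT;\mathbb{Z})$ of the labels in $E_{i(e)}$ and $E_{t(e)}$ with $\tilde\alpha(l)\equiv\tilde\alpha(\nabla_el)\bmod\alpha(e)$ for all $l\in E_{i(e)}$; the element is independent of these choices. *)

theory Defs
  imports
    "HOL-Computational_Algebra.Polynomial"
    "HOL-Library.Z2"
    "HOL-Library.Product_Plus"
    "HOL-Library.FuncSet"
    "Graph_Theory.Graph_Theory"
begin

section \<open>The lattice of labels and the cohomology of the classifying space\<close>

definition zscale :: "int \<Rightarrow> int \<times> int \<Rightarrow> int \<times> int" where
  "zscale k a = (k * fst a, k * snd a)"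

definition lin_indep :: "int \<times> int \<Rightarrow> int \<times> int \<Rightarrow> bool" where
  "lin_indep a b \<longleftrightarrow> (\<forall>m n. zscale m a + zscale n b = 0 \<longrightarrow> m = 0 \<and> n = 0)"

text \<open>Elements of \<open>\<int>\<^sup>2/\<plusminus>1\<close> are equivalence classes, i.e. the sets \<open>{a, -a}\<close>; a lift of
  a label is therefore simply an element of it.\<close>

definition pm_rel :: "((int \<times> int) \<times> (int \<times> int)) set" where
  "pm_rel = {(a, b). b = a \<or> b = - a}"

definition pm_labels :: "(int \<times> int) set set" where
  "pm_labels = UNIV // pm_rel"

text \<open>Congruence modulo a label; the choice of the representative \<open>c\<close> is immaterial.\<close>

definition cong_label :: "int \<times> int \<Rightarrow> int \<times> int \<Rightarrow> (int \<times> int) set \<Rightarrow> bool" where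
  "cong_label a b A \<longleftrightarrow> (\<exists>c\<in>A. \<exists>k. a - b = zscale k c)"

text \<open>\<open>H\<^sup>*(BT; A) = A[x, y]\<close> is modelled as \<open>A[x][y]\<close>; the element \<open>(p, q)\<close> of
  \<open>H\<^sup>2(BT; \<int>) = \<int>\<^sup>2\<close> is the linear form \<open>p x + q y\<close>, here with coefficients mapped to \<open>A\<close>.\<close>

definition lin :: "int \<times> int \<Rightarrow> 'r::comm_ring_1 poly poly" where
  "lin a = [:[:0, of_int (fst a):], [:of_int (snd a):]:]"

definition red :: "int poly poly \<Rightarrow> bit poly poly" where
  "red = map_poly (map_poly of_int)"

section \<open>GKM graphs\<close>

text \<open>A graph is a digraph with a fixed-point free reversal \<open>arev\<close> of its arcs: the arcs are the
  oriented edges, \<open>tail\<close> and \<open>head\<close> are the initial and terminal vertex, and \<open>out_arcs G v\<close>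
  is \<open>E\<^sub>v\<close>. The unoriented edges are the sets \<open>{e, arev e}\<close>.\<close>

definition uedge :: "('b \<Rightarrow> 'b) \<Rightarrow> 'b \<Rightarrow> 'b set" where
  "uedge arev e = {e, arev e}"

definition uedges :: "('a, 'b) pre_digraph \<Rightarrow> ('b \<Rightarrow> 'b) \<Rightarrow> 'b set set" where
  "uedges G arev = uedge arev ` arcs G"

definition connection :: "('a, 'b) pre_digraph \<Rightarrow> ('b \<Rightarrow> 'b) \<Rightarrow> ('b \<Rightarrow> 'b \<Rightarrow> 'b) \<Rightarrow> bool" where
  "connection G arev nabla \<longleftrightarrow>
     (\<forall>e\<in>arcs G.
        bij_betw (nabla e) (out_arcs G (tail G e)) (out_arcs G (head G e)) \<and>
        nabla e e = arev e \<and>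
        (\<forall>f\<in>out_arcs G (tail G e). nabla (arev e) (nabla e f) = f))"

definition compatible_connection ::
  "('a, 'b) pre_digraph \<Rightarrow> ('b \<Rightarrow> 'b) \<Rightarrow> ('b set \<Rightarrow> (int \<times> int) set) \<Rightarrow> ('b \<Rightarrow> 'b \<Rightarrow> 'b) \<Rightarrow> bool"
where
  "compatible_connection G arev \<alpha> nabla \<longleftrightarrow>
     connection G arev nabla \<and>
     (\<forall>e\<in>arcs G. \<forall>f\<in>out_arcs G (tail G e).
        \<exists>a\<in>\<alpha> (uedge arev (nabla e f)). \<exists>b\<in>\<alpha> (uedge arev f).
          cong_label a b (\<alpha> (uedge arev e)))"

locale T2_gkm_graph =
  bidirected_digraph G arev + fin_digraph G + loopfree_digraph G
  for G :: "('a, 'b) pre_digraph" and arev :: "'b \<Rightarrow> 'b" +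
  fixes n :: nat and \<alpha> :: "'b set \<Rightarrow> (int \<times> int) set"
  assumes valent: "v \<in> verts G \<Longrightarrow> card (out_arcs G v) = n"
    and label: "\<epsilon> \<in> uedges G arev \<Longrightarrow> \<alpha> \<epsilon> \<in> pm_labels"
    and labels_indep:
      "\<lbrakk>v \<in> verts G; e \<in> out_arcs G v; f \<in> out_arcs G v; e \<noteq> f;
        a \<in> \<alpha> (uedge arev e); b \<in> \<alpha> (uedge arev f)\<rbrakk> \<Longrightarrow> lin_indep a b"
    and ex_compatible: "\<exists>nabla. compatible_connection G arev \<alpha> nabla"

definition label_lift ::
  "('a, 'b) pre_digraph \<Rightarrow> ('b \<Rightarrow> 'b) \<Rightarrow> ('b set \<Rightarrow> (int \<times> int) set) \<Rightarrow> ('b set \<Rightarrow> int \<times> int) \<Rightarrow> bool"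
where
  "label_lift G arev \<alpha> a \<longleftrightarrow> (\<forall>\<epsilon>\<in>uedges G arev. a \<epsilon> \<in> \<alpha> \<epsilon>)"

definition edge_orientation ::
  "('a, 'b) pre_digraph \<Rightarrow> ('b \<Rightarrow> 'b) \<Rightarrow> ('b set \<Rightarrow> 'b) \<Rightarrow> bool" where
  "edge_orientation G arev ori \<longleftrightarrow> (\<forall>\<epsilon>\<in>uedges G arev. ori \<epsilon> \<in> \<epsilon>)"

section \<open>Orientability\<close>

definition conn_sign ::
  "('b \<Rightarrow> 'b) \<Rightarrow> ('b set \<Rightarrow> (int \<times> int) set) \<Rightarrow> ('b \<Rightarrow> 'b \<Rightarrow> 'b) \<Rightarrow> ('b set \<Rightarrow> int \<times> int) \<Rightarrow> 'b \<Rightarrow> 'b \<Rightarrow> int"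
where
  "conn_sign arev \<alpha> nabla a e f =
     (THE s. s \<in> {1, -1} \<and>
        cong_label (a (uedge arev f)) (zscale s (a (uedge arev (nabla e f)))) (\<alpha> (uedge arev e)))"

definition edge_sign ::
  "('a, 'b) pre_digraph \<Rightarrow> ('b \<Rightarrow> 'b) \<Rightarrow> ('b set \<Rightarrow> (int \<times> int) set) \<Rightarrow> ('b \<Rightarrow> 'b \<Rightarrow> 'b) \<Rightarrow>
   ('b set \<Rightarrow> int \<times> int) \<Rightarrow> 'b \<Rightarrow> int"
where
  "edge_sign G arev \<alpha> nabla a e =
     - (\<Prod>f\<in>out_arcs G (tail G e) - {e}. conn_sign arev \<alpha> nabla a e f)"

definition gkm_orientable ::
  "('a, 'b) pre_digraph \<Rightarrow> ('b \<Rightarrow> 'b) \<Rightarrow> ('b set \<Rightarrow> (int \<times> int) set) \<Rightarrow> bool" where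
  "gkm_orientable G arev \<alpha> \<longleftrightarrow>
     (\<exists>nabla a. compatible_connection G arev \<alpha> nabla \<and> label_lift G arev \<alpha> a \<and>
        (\<forall>u p. pre_digraph.awalk G u p u \<longrightarrow>
           prod_list (map (edge_sign G arev \<alpha> nabla a) p) = 1))"

section \<open>Equivariant cohomology of a GKM graph and the map \<open>\<Psi>\<close>\<close>

text \<open>Finite direct sums indexed by \<open>I\<close> are sets of extensional functions on \<open>I\<close>. The total
  cohomology (all degrees at once) is used throughout, so the degree shift in \<open>B\<^sup>*(\<Gamma>, 2)\<close>
  is not visible.\<close>

definition gkm_cohom ::
  "('a, 'b) pre_digraph \<Rightarrow> ('b \<Rightarrow> 'b) \<Rightarrow> ('b set \<Rightarrow> (int \<times> int) set) \<Rightarrow>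
   ('a \<Rightarrow> 'r::comm_ring_1 poly poly) set"
where
  "gkm_cohom G arev \<alpha> =
     {f \<in> verts G \<rightarrow>\<^sub>E UNIV. \<forall>e\<in>arcs G. \<forall>c\<in>\<alpha> (uedge arev e).
        lin c dvd f (tail G e) - f (head G e)}"

definition even_edges ::
  "('a, 'b) pre_digraph \<Rightarrow> ('b \<Rightarrow> 'b) \<Rightarrow> ('b set \<Rightarrow> (int \<times> int) set) \<Rightarrow> 'b set set" where
  "even_edges G arev \<alpha> = {\<epsilon> \<in> uedges G arev. \<forall>c\<in>\<alpha> \<epsilon>. even (fst c) \<and> even (snd c)}"

definition B2 ::
  "('a, 'b) pre_digraph \<Rightarrow> ('b \<Rightarrow> 'b) \<Rightarrow> ('b set \<Rightarrow> (int \<times> int) set) \<Rightarrow>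
   ('b set \<Rightarrow> bit poly poly) set"
where
  "B2 G arev \<alpha> = (even_edges G arev \<alpha> \<rightarrow>\<^sub>E UNIV)"

text \<open>The map \<open>\<Psi>\<close>, depending a priori on orientations \<open>ori\<close> of the edges and signs of the
  labels (a lift \<open>a\<close>). On \<open>gkm_cohom\<close> the division is exact.\<close>

definition Psi ::
  "('a, 'b) pre_digraph \<Rightarrow> ('b \<Rightarrow> 'b) \<Rightarrow> ('b set \<Rightarrow> (int \<times> int) set) \<Rightarrow>
   ('b set \<Rightarrow> 'b) \<Rightarrow> ('b set \<Rightarrow> int \<times> int) \<Rightarrow>
   ('a \<Rightarrow> int poly poly) \<Rightarrow> ('a \<Rightarrow> bit poly poly) \<times> ('b set \<Rightarrow> bit poly poly)"
where
  "Psi G arev \<alpha> ori a f =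
     ((\<lambda>v\<in>verts G. red (f v)),
      (\<lambda>\<epsilon>\<in>even_edges G arev \<alpha>.
         red ((f (tail G (ori \<epsilon>)) - f (head G (ori \<epsilon>))) div lin (a \<epsilon>))))"

section \<open>The total equivariant Stiefel-Whitney class\<close>

text \<open>Admissible choices at an oriented edge \<open>e\<close>: a compatible connection and lifts of the labels
  of the oriented edges emanating from the two ends of \<open>e\<close>. These lifts are local to \<open>e\<close>. Both an
  oriented edge and its reverse may occur among these; their lifts are not required to agree.\<close>

definition sw_choice ::
  "('a, 'b) pre_digraph \<Rightarrow> ('b \<Rightarrow> 'b) \<Rightarrow> ('b set \<Rightarrow> (int \<times> int) set) \<Rightarrow> 'b \<Rightarrow>
   ('b \<Rightarrow> 'b \<Rightarrow> 'b) \<Rightarrow> ('b \<Rightarrow> int \<times> int) \<Rightarrow> bool"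
where
  "sw_choice G arev \<alpha> e nabla b \<longleftrightarrow>
     compatible_connection G arev \<alpha> nabla \<and>
     (\<forall>l\<in>out_arcs G (tail G e) \<union> out_arcs G (head G e). b l \<in> \<alpha> (uedge arev l)) \<and>
     (\<forall>l\<in>out_arcs G (tail G e). cong_label (b l) (b (nabla e l)) (\<alpha> (uedge arev e)))"

definition sw_edge ::
  "('a, 'b) pre_digraph \<Rightarrow> 'b \<Rightarrow> ('b \<Rightarrow> int \<times> int) \<Rightarrow> bit poly poly" where
  "sw_edge G e b =
     red (((\<Prod>l\<in>out_arcs G (tail G e). 1 + lin (b l)) -
           (\<Prod>l\<in>out_arcs G (head G e). 1 + lin (b l))) div lin (b e))"

text \<open>Here \<open>b \<epsilon>\<close> is the system of lifts chosen for the edge \<open>\<epsilon>\<close>, and \<open>a\<close> is an arbitrary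
  lift of all labels, used only to write down \<open>r(\<alpha>(l))\<close>.\<close>

definition total_sw ::
  "('a, 'b) pre_digraph \<Rightarrow> ('b \<Rightarrow> 'b) \<Rightarrow> ('b set \<Rightarrow> (int \<times> int) set) \<Rightarrow>
   ('b set \<Rightarrow> 'b) \<Rightarrow> ('b set \<Rightarrow> int \<times> int) \<Rightarrow> ('b set \<Rightarrow> 'b \<Rightarrow> int \<times> int) \<Rightarrow>
   ('a \<Rightarrow> bit poly poly) \<times> ('b set \<Rightarrow> bit poly poly)"
where
  "total_sw G arev \<alpha> ori a b =
     ((\<lambda>v\<in>verts G. \<Prod>l\<in>out_arcs G v. 1 + red (lin (a (uedge arev l)))),
      (\<lambda>\<epsilon>\<in>even_edges G arev \<alpha>. sw_edge G (ori \<epsilon>) (b \<epsilon>)))"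

section \<open>The choices exist, and \<open>\<Psi>\<close> has the expected codomain\<close>

lemma pm_labels_iff: "A \<in> pm_labels \<longleftrightarrow> (\<exists>a. A = {a, - a})"
  by (auto simp: pm_labels_def pm_rel_def quotient_def)

lemma cong_label_minus:
  assumes "cong_label a b A" shows "cong_label (- a) (- b) A"
proof -
  from assms obtain c k where "c \<in> A" "a - b = zscale k c" by (auto simp: cong_label_def)
  moreover from this have "(- a) - (- b) = zscale (- k) c"
    by (auto simp: zscale_def prod_eq_iff)
  ultimately show ?thesis unfolding cong_label_def by blast
qed

lemma cong_label_sym:
  assumes "cong_label a b A" shows "cong_label b a A"
proof -
  from assms obtain c k where "c \<in> A" "a - b = zscale k c" by (auto simp: cong_label_def)
  moreover from this have "b - a = zscale (- k) c"
    by (auto simp: zscale_def prod_eq_iff)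
  ultimately show ?thesis unfolding cong_label_def by blast
qed

lemma map_poly_of_int_mult:
  "map_poly of_int (p * q) = (map_poly of_int p * map_poly of_int q :: 'r::comm_ring_1 poly)"
  by (rule poly_eqI) (simp add: coeff_map_poly coeff_mult)

lemma map_poly_of_int_diff:
  "map_poly of_int (p - q) = (map_poly of_int p - map_poly of_int q :: 'r::comm_ring_1 poly)"
  by (rule poly_eqI) (simp add: coeff_map_poly)

lemma map_poly_of_int_sum:
  "map_poly of_int (sum h S) = (\<Sum>i\<in>S. map_poly of_int (h i) :: 'r::comm_ring_1 poly)"
  by (rule poly_eqI) (simp add: coeff_map_poly coeff_sum)

lemma red_mult: "red (p * q) = red p * red q"
  unfolding red_def
  by (rule poly_eqI)
     (simp add: coeff_map_poly[where f = "map_poly of_int"] coeff_mult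
       map_poly_of_int_mult map_poly_of_int_sum)

lemma red_diff: "red (p - q) = red p - red q"
  unfolding red_def
  by (rule poly_eqI)
     (simp add: coeff_map_poly[where f = "map_poly of_int"] map_poly_of_int_diff)

lemma red_lin: "red (lin c) = lin c"
  by (simp add: red_def lin_def map_poly_pCons)

context T2_gkm_graph
begin

lemma ex_label_lift: "\<exists>a. label_lift G arev \<alpha> a"
proof -
  have "\<forall>\<epsilon>\<in>uedges G arev. \<exists>x. x \<in> \<alpha> \<epsilon>"
    using label pm_labels_iff by blast
  then show ?thesis unfolding label_lift_def by metis
qed

lemma ex_edge_orientation: "\<exists>ori. edge_orientation G arev ori"
proof -
  have "\<forall>\<epsilon>\<in>uedges G arev. \<exists>x. x \<in> \<epsilon>"
    by (auto simp: uedges_def uedge_def)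
  then show ?thesis unfolding edge_orientation_def by metis
qed

lemma ex_sw_choice:
  assumes e: "e \<in> arcs G"
  shows "\<exists>nabla b. sw_choice G arev \<alpha> e nabla b"
proof -
  obtain nabla where c: "compatible_connection G arev \<alpha> nabla" using ex_compatible by blast
  obtain a where a: "label_lift G arev \<alpha> a" using ex_label_lift by blast
  let ?I = "out_arcs G (tail G e)" and ?T = "out_arcs G (head G e)"
  let ?A = "\<alpha> (uedge arev e)"
  have bij: "bij_betw (nabla e) ?I ?T"
    using c e by (simp add: compatible_connection_def connection_def)
  have ue: "uedge arev l \<in> uedges G arev" if "l \<in> arcs G" for l
    using that by (simp add: uedges_def)
  have cl: "\<exists>y. y \<in> \<alpha> (uedge arev (nabla e l)) \<and> cong_label (a (uedge arev l)) y ?A"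
    if l: "l \<in> ?I" for l
  proof -
    from c e l obtain x y where x: "x \<in> \<alpha> (uedge arev (nabla e l))"
      and y: "y \<in> \<alpha> (uedge arev l)" and xy: "cong_label x y ?A"
      unfolding compatible_connection_def by blast
    have nl: "nabla e l \<in> ?T" using bij l by (auto simp: bij_betw_def)
    have yx: "cong_label y x ?A" using cong_label_sym[OF xy] .
    have "a (uedge arev l) \<in> \<alpha> (uedge arev l)"
      using a l ue unfolding label_lift_def by auto
    moreover obtain z where "\<alpha> (uedge arev l) = {z, - z}"
      using label[OF ue] l pm_labels_iff by (metis in_out_arcs_conv)
    ultimately have "a (uedge arev l) = y \<or> a (uedge arev l) = - y" using y by auto
    moreover have "- x \<in> \<alpha> (uedge arev (nabla e l))"
    proof -
      obtain w where "\<alpha> (uedge arev (nabla e l)) = {w, - w}"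
        using label[OF ue] nl pm_labels_iff by (metis in_out_arcs_conv)
      then show ?thesis using x by auto
    qed
    ultimately show ?thesis using x yx cong_label_minus by metis
  qed
  define g where "g l = (SOME y. y \<in> \<alpha> (uedge arev (nabla e l)) \<and>
      cong_label (a (uedge arev l)) y ?A)" for l
  have g: "g l \<in> \<alpha> (uedge arev (nabla e l)) \<and> cong_label (a (uedge arev l)) (g l) ?A"
    if "l \<in> ?I" for l
    unfolding g_def using someI_ex[OF cl[OF that]] .
  define b where "b l = (if l \<in> ?I then a (uedge arev l) else g (inv_into ?I (nabla e) l))" for l
  have disj: "?I \<inter> ?T = {}" using no_loops[OF e] by auto
  have bn: "b (nabla e l) = g l" if "l \<in> ?I" for l
  proof -
    have "nabla e l \<in> ?T" using bij that by (auto simp: bij_betw_def)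
    then have "nabla e l \<notin> ?I" using disj by blast
    then have "b (nabla e l) = g (inv_into ?I (nabla e) (nabla e l))"
      unfolding b_def by (rule if_not_P)
    then show ?thesis
      using bij that by (simp only: bij_betw_def inv_into_f_f)
  qed
  have "b l \<in> \<alpha> (uedge arev l)" if "l \<in> ?I \<union> ?T" for l
  proof (cases "l \<in> ?I")
    case True
    then show ?thesis using a ue unfolding label_lift_def b_def by auto
  next
    case False
    then have "l \<in> ?T" using that by blast
    then obtain m where "m \<in> ?I" "l = nabla e m"
      using bij by (metis bij_betw_imp_surj_on imageE)
    then show ?thesis using bn g by auto
  qed
  moreover have "cong_label (b l) (b (nabla e l)) ?A" if "l \<in> ?I" for l
    using bn[OF that] g[OF that] that by (simp add: b_def)
  ultimately have "sw_choice G arev \<alpha> e nabla b"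
    using c unfolding sw_choice_def by blast
  then show ?thesis by blast
qed

lemma Psi_funcset:
  "Psi G arev \<alpha> ori a \<in> gkm_cohom G arev \<alpha> \<rightarrow> gkm_cohom G arev \<alpha> \<times> B2 G arev \<alpha>"
proof
  fix f :: "'a \<Rightarrow> int poly poly" assume f: "f \<in> gkm_cohom G arev \<alpha>"
  have "lin c dvd red (f (tail G e)) - red (f (head G e))"
    if "e \<in> arcs G" "c \<in> \<alpha> (uedge arev e)" for e c
  proof -
    have "lin c dvd f (tail G e) - f (head G e)" using f that by (simp add: gkm_cohom_def)
    then show ?thesis
      by (metis dvd_def red_diff red_mult red_lin)
  qed
  then show "Psi G arev \<alpha> ori a f \<in> gkm_cohom G arev \<alpha> \<times> B2 G arev \<alpha>"
    by (simp add: Psi_def gkm_cohom_def B2_def)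
qed

end

end

theory Submission
  imports Defs
begin

text \<open>Call a choice of signs of the labels, one for each oriented edge, consistent if
  \<open>b(l) \<equiv> b(\<nabla>\<^sub>e l)\<close> mod \<open>\<alpha>(e)\<close> for all \<open>e\<close> and \<open>l\<close> with a common initial vertex. For such
  a choice the class \<open>f\<^sub>v = \<Prod>\<^sub>l (1 + b(l))\<close> is integral and is a preimage of the total
  Stiefel--Whitney class, because the latter does not depend on local choices. A consistent choice
  exists iff for each connection path (the boundary of a two-dimensional face) the signs by which
  its normal label is transported multiply to \<open>1\<close>. Orientability reduces this to the tangential
  signs, and these multiply correctly because determinants of consecutive labels return to their
  initial value along a closed path.\<close>

section \<open>Common colourings of two involutions\<close>

text \<open>In the dihedral action generated by \<open>s\<close> and \<open>r\<close>, a power of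
  \<open>T\<close> followed by \<open>s\<close> is a reflection, conjugate to \<open>s\<close> or
  \<open>r\<close>, hence without fixed points. The induction carries out this conjugation:
  \<open>(T ^^ (j + 2)) x = s x\<close> would give \<open>(T ^^ j) (T x) = s (T x)\<close>.\<close>

lemma funpow_reflection_neq:
  assumes s: "\<And>x. x \<in> S \<Longrightarrow> s x \<in> S \<and> s (s x) = x \<and> s x \<noteq> x"
    and r: "\<And>x. x \<in> S \<Longrightarrow> r x \<in> S \<and> r (r x) = x \<and> r x \<noteq> x"
    and T: "\<And>x. T x = s (r x)"
    and x: "x \<in> S"
  shows "(T ^^ k) x \<noteq> s x"
  using x
proof (induction k arbitrary: x rule: less_induct)
  case (less k)
  have closed: "(T ^^ j) y \<in> S" if "y \<in> S" for j y
    using that s r by (induction j) (simp_all add: T)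
  consider "k = 0" | "k = 1" | j where "k = Suc (Suc j)"
    by (metis One_nat_def not0_implies_Suc)
  then show ?case
  proof cases
    case 1
    then show ?thesis using s[OF less.prems] by auto
  next
    case 2
    have "s (s (r x)) = r x" "s (s x) = x" "r x \<noteq> x" using s r less.prems by auto
    then have "s (r x) \<noteq> s x" by metis
    then show ?thesis by (simp add: 2 T)
  next
    case (3 j)
    have x': "T x \<in> S" using less.prems s r by (simp add: T)
    have IH: "(T ^^ j) (T x) \<noteq> s (T x)"
      using less.IH[OF _ x', of j] 3 by simp
    show ?thesis
    proof
      assume "(T ^^ k) x = s x"
      moreover have "(T ^^ k) x = s (r ((T ^^ j) (T x)))"
        by (simp add: 3 funpow_swap1 flip: T)
      ultimately have "s (s (r ((T ^^ j) (T x)))) = s (s x)" by simp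
      then have "r ((T ^^ j) (T x)) = x"
        using s r closed[OF x'] less.prems by simp
      then have "(T ^^ j) (T x) = r x" using r closed[OF x'] by metis
      also have "r x = s (T x)" using s r less.prems by (simp add: T)
      finally show False using IH by simp
    qed
  qed
qed

text \<open>The colouring must be constant on \<open>T\<close>-orbits, and both \<open>s\<close> and
  \<open>r\<close> exchange the orbit of \<open>x\<close> with that of \<open>s x\<close>. These two
  are distinct, so it suffices to choose one orbit from each pair.\<close>

lemma two_involutions_colouring:
  assumes s: "\<And>x. x \<in> S \<Longrightarrow> s x \<in> S \<and> s (s x) = x \<and> s x \<noteq> x"
    and r: "\<And>x. x \<in> S \<Longrightarrow> r x \<in> S \<and> r (r x) = x \<and> r x \<noteq> x"
  shows "\<exists>c. \<forall>x\<in>S. c (s x) = (\<not> c x) \<and> c (r x) = (\<not> c x)"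
proof -
  define T where "T x = s (r x)" for x
  have TS: "T x \<in> S" if "x \<in> S" for x using that s r by (simp add: T_def)
  have TnS: "(T ^^ n) x \<in> S" if "x \<in> S" for n x
    using that TS by (induction n) auto
  have T_inj: "y = z" if "T y = T z" "y \<in> S" "z \<in> S" for y z
  proof -
    have "s (s (r y)) = s (s (r z))" using that by (simp add: T_def)
    then have "r (r y) = r (r z)" using that s r by simp
    then show ?thesis using that r by simp
  qed
  have inj: "y = z" if "(T ^^ n) y = (T ^^ n) z" "y \<in> S" "z \<in> S" for y z n
    using that by (induction n) (auto dest: T_inj[OF _ TnS TnS])
  have neq: "(T ^^ k) x \<noteq> s x" if "x \<in> S" for k x
    using funpow_reflection_neq[OF s r T_def that] .
  \<comment> \<open>Only forward powers of \<open>T\<close> occur: points are related if their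
    forward orbits meet, which on \<open>S\<close> amounts to lying in one orbit.\<close>
  define E where "E x y \<longleftrightarrow> (\<exists>n m. (T ^^ n) x = (T ^^ m) y)" for x y
  have E_trans: "E x z" if "E x y" "E y z" for x y z
  proof -
    from that obtain n m p q where "(T ^^ n) x = (T ^^ m) y" and pq: "(T ^^ p) y = (T ^^ q) z"
      unfolding E_def by blast
    then have "(T ^^ (p + n)) x = (T ^^ p) ((T ^^ m) y)" by (simp add: funpow_add)
    also have "\<dots> = (T ^^ (m + p)) y" by (simp add: add.commute[of m p] funpow_add)
    also have "\<dots> = (T ^^ (m + q)) z" using pq by (simp add: funpow_add)
    finally have "(T ^^ (p + n)) x = (T ^^ (m + q)) z" .
    then show ?thesis unfolding E_def by (intro exI)
  qed
  have E_sym: "E y x" if "E x y" for x y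
    using that unfolding E_def by (elim exE) (intro exI, erule sym)
  have E_refl: "E x x" for x
    unfolding E_def by (intro exI, rule refl)
  have E_T: "E (T x) x" for x
  proof -
    have "(T ^^ 0) (T x) = (T ^^ 1) x" by simp
    then show ?thesis unfolding E_def by (intro exI)
  qed
  have not_E: "\<not> E x (s x)" if x: "x \<in> S" for x
  proof
    assume "E x (s x)"
    then obtain n m where nm: "(T ^^ n) x = (T ^^ m) (s x)" unfolding E_def by blast
    show False
    proof (cases "m \<le> n")
      case True
      then have "(T ^^ m) ((T ^^ (n - m)) x) = (T ^^ m) (s x)"
        using nm funpow_add[of m "n - m" T] by simp
      then have "(T ^^ (n - m)) x = s x" by (rule inj) (use x s TnS in simp_all)
      then show False using neq[OF x] by blast
    next
      case False
      then have "(T ^^ n) x = (T ^^ n) ((T ^^ (m - n)) (s x))"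
        using nm funpow_add[of n "m - n" T] by simp
      then have "x = (T ^^ (m - n)) (s x)" by (rule inj) (use x s TnS in simp_all)
      then show False using neq[of "s x" "m - n"] x s by simp
    qed
  qed
  define C where "C x = Collect (E x)" for x
  have C_eq: "C x = C y" if "E x y" for x y
    unfolding C_def using E_trans[OF that] E_trans[OF E_sym[OF that]] by blast
  have C_neq: "C x \<noteq> C (s x)" if "x \<in> S" for x
    using not_E[OF that] E_refl unfolding C_def by blast
  \<comment> \<open>\<open>SOME\<close> sees only the unordered pair, which is the same set for
    \<open>x\<close> and \<open>s x\<close>; hence exactly one of the two gets the colour
    \<open>True\<close>.\<close>
  define c where "c x \<longleftrightarrow> C x = (SOME A. A \<in> {C x, C (s x)})" for x
  have some: "(SOME A. A \<in> {C x, C (s x)}) \<in> {C x, C (s x)}" for x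
    by (rule someI_ex) blast
  have "c (s x) = (\<not> c x) \<and> c (r x) = (\<not> c x)" if x: "x \<in> S" for x
  proof
    have ss: "s (s x) = x" and rr: "r (r x) = x" using s r x by auto
    have pair: "{C (s x), C x} = {C x, C (s x)}" by blast
    show *: "c (s x) = (\<not> c x)"
      using some[of x] C_neq[OF x] unfolding c_def ss pair by auto
    \<comment> \<open>The pair of classes of \<open>r x\<close> is again that of \<open>x\<close>,
      because \<open>s (r x) = T x\<close> and \<open>T (r x) = s x\<close>.\<close>
    have "C (s (r x)) = C x" using C_eq[OF E_T] by (simp add: T_def)
    moreover have "C (r x) = C (s x)"
      using C_eq[OF E_T, of "r x"] rr by (simp add: T_def)
    ultimately have "c (r x) = c (s x)" unfolding c_def ss by simp
    with * show "c (r x) = (\<not> c x)" by simp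
  qed
  then show ?thesis by (intro exI[of _ c]) blast
qed

section \<open>Linear forms and reduction mod 2\<close>

lemma lin_diff: "lin (a - b) = lin a - lin b"
  by (simp add: lin_def)

lemma lin_zscale: "lin (zscale k a) = of_int k * lin a"
  by (simp add: lin_def zscale_def of_int_poly mult.commute)

lemma lin_uminus: "lin (- a) = - lin a"
  by (simp add: lin_def)

lemma lin_int_eq_0_iff: "lin a = (0 :: int poly poly) \<longleftrightarrow> a = 0"
  by (auto simp: lin_def prod_eq_iff)

lemma bit_poly_add_self: "p + p = (0 :: bit poly poly)"
  by (intro poly_eqI) (simp only: coeff_add coeff_0 add_bit_eq_xor xor_self_eq)

lemma bit_poly_uminus: "- p = (p :: bit poly poly)"
  by (metis add_eq_0_iff bit_poly_add_self)

lemma of_int_bit_poly: "(of_int k :: bit poly poly) = (if even k then 0 else 1)"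
proof -
  have "(of_int k :: bit) = (if even k then 0 else 1)"
    by (cases "even k") (auto elim!: evenE oddE)
  then show ?thesis by (simp add: of_int_poly one_pCons)
qed

lemma red_add: "red (p + q) = red p + red q"
  using red_diff[of "p + q" q] by (simp add: algebra_simps)

lemma red_uminus: "red (- p) = red p"
  using red_diff[of 0 p] bit_poly_uminus[of "red p"] by (simp add: red_def)

lemma red_of_int: "red (of_int k) = of_int k"
  by (simp add: red_def of_int_poly map_poly_pCons)

lemma red_1: "red 1 = 1"
  using red_of_int[of 1] by simp

lemma red_prod: "red (prod f A) = (\<Prod>x\<in>A. red (f x))"
  by (induction A rule: infinite_finite_induct) (simp_all add: red_1 red_mult)

lemma zscale_1 [simp]: "zscale 1 a = a"
  by (simp add: zscale_def)

lemma zscale_m1 [simp]: "zscale (- 1) a = - a"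
  by (simp add: zscale_def prod_eq_iff)

lemma zscale_zscale: "zscale k (zscale l a) = zscale (k * l) a"
  by (simp add: zscale_def)

section \<open>Linear independence and parities of coefficients\<close>

lemma lin_indepD:
  assumes "lin_indep x y" "zscale m x + zscale n y = 0"
  shows "m = 0 \<and> n = 0"
  using assms unfolding lin_indep_def by blast

lemma lin_indep_nonzero:
  assumes "lin_indep x y" shows "y \<noteq> 0"
proof
  assume "y = 0"
  then have "zscale 0 x + zscale 1 y = 0" by (simp add: zscale_def prod_eq_iff)
  from lin_indepD[OF assms this] show False by simp
qed

text \<open>Eliminating \<open>x'\<close> leaves a relation between \<open>x\<close> and
  \<open>z\<close>, so independence forces \<open>s = t\<close> and \<open>m = t * k\<close>. This
  compares two choices of signs when the connections agree.\<close>

lemma parity_same: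
  assumes indep: "lin_indep x z"
    and signs: "s \<in> {1, - 1}" "t \<in> {1, - 1}"
    and k: "x - x' = zscale k z"
    and m: "zscale s x - zscale t x' = zscale m z"
  shows "even k \<longleftrightarrow> even m"
proof -
  have "zscale (s - t) x + zscale (t * k - m) z = 0"
    using signs k m by (auto simp: zscale_def prod_eq_iff algebra_simps)
  from lin_indepD[OF indep this] have "s - t = 0" "t * k - m = 0" by simp_all
  then show ?thesis using signs by auto
qed

text \<open>Here the second connection exchanges the targets \<open>x'\<close> and
  \<open>y'\<close>. Running from \<open>x\<close> through \<open>y'\<close>, \<open>y\<close>,
  \<open>x'\<close> back to \<open>x\<close> writes \<open>x\<close> as a sign times
  \<open>x\<close> plus a multiple of \<open>z\<close>, and independence kills that
  multiple.\<close>

lemma parity_swapped: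
  assumes indep: "lin_indep x z"
    and signs: "s \<in> {1, - 1}" "t \<in> {1, - 1}" "s' \<in> {1, - 1}" "t' \<in> {1, - 1}"
    and k: "x - x' = zscale k z" and l: "y - y' = zscale l z"
    and m: "zscale s x - zscale s' y' = zscale m z"
    and n: "zscale t y - zscale t' x' = zscale n z"
  shows "even (k + l) \<longleftrightarrow> even (m + n)"
proof -
  \<comment> \<open>\<open>K\<close> is the coefficient of \<open>z\<close> collected on this round
    trip; the signs being odd, its parity is that of \<open>k + l + m + n\<close>.\<close>
  define K where "K = s * s' * t * (n - t' * k) + s * (m - s' * l)"
  have sq: "s * s = 1" "t * t = 1" using signs by auto
  have "fst x = s * (s * fst x)" "snd x = s * (s * snd x)"
       "fst y = t * (t * fst y)" "snd y = t * (t * snd y)"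
    using sq by (simp_all flip: mult.assoc)
  moreover have "s * fst x = s' * fst y' + m * fst z" "s * snd x = s' * snd y' + m * snd z"
       "t * fst y = t' * fst x' + n * fst z" "t * snd y = t' * snd x' + n * snd z"
       "fst x' = fst x - k * fst z" "snd x' = snd x - k * snd z"
       "fst y' = fst y - l * fst z" "snd y' = snd y - l * snd z"
    using k l m n by (auto simp: zscale_def prod_eq_iff algebra_simps)
  ultimately have
    "fst x = s * (s' * (t * (t' * (fst x - k * fst z) + n * fst z) - l * fst z) + m * fst z)"
    "snd x = s * (s' * (t * (t' * (snd x - k * snd z) + n * snd z) - l * snd z) + m * snd z)"
    by metis+
  then have "zscale (1 - s * s' * t * t') x + zscale (- K) z = 0"
    by (simp add: zscale_def prod_eq_iff K_def algebra_simps)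
  from lin_indepD[OF indep this] have "K = 0" by simp
  moreover have "odd s" "odd t" "odd s'" "odd t'" using signs by auto
  then have "even K \<longleftrightarrow> even ((n - k) + (m - l))" unfolding K_def by simp
  ultimately show ?thesis by auto
qed

text \<open>\<open>B\<close> and \<open>S * B\<close> stand for the lifts of the label of an edge at
  its two ends, \<open>X\<close> and \<open>Y\<close> for the other labels at one end,
  \<open>X - K * B\<close> and \<open>Y - L * B\<close> for their transports. The explicit quotient
  by \<open>B\<close> is what is reduced mod 2 later.\<close>

lemma product_difference_factor:
  fixes B :: "'r::comm_ring_1"
  shows "(1 + B) * ((1 + X) * (1 + Y)) - (1 + S * B) * ((1 + (X - K * B)) * (1 + (Y - L * B))) =
    B * ((1 + X) * (1 + Y) - S * ((1 + (X - K * B)) * (1 + (Y - L * B)))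
      + K * (1 + Y) + L * (1 + X) - K * L * B)"
  by (simp add: algebra_simps)

lemma lin_even_bit:
  assumes "even (fst c)" "even (snd c)"
  shows "lin c = (0 :: bit poly poly)"
proof -
  have "of_int (fst c) = (0::bit)" "of_int (snd c) = (0::bit)"
    using assms by (auto elim!: evenE)
  then show ?thesis by (simp add: lin_def)
qed

lemma lin_uminus_bit: "lin (- c) = (lin c :: bit poly poly)"
  by (simp only: lin_uminus bit_poly_uminus)

section \<open>Determinants of pairs of labels\<close>

definition det2 :: "int \<times> int \<Rightarrow> int \<times> int \<Rightarrow> int" where
  "det2 x y = fst x * snd y - snd x * fst y"

lemma det2_swap: "det2 y x = - det2 x y"
  by (simp add: det2_def)

lemma det2_cong:
  assumes "x - zscale t x' = zscale k y"
  shows "det2 x y = t * det2 x' y"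
proof -
  have "fst x = t * fst x' + k * fst y" "snd x = t * snd x' + k * snd y"
    using assms by (auto simp: zscale_def prod_eq_iff algebra_simps)
  then show ?thesis by (simp add: det2_def algebra_simps)
qed

lemma lin_indep_det2:
  assumes "lin_indep x y" shows "det2 x y \<noteq> 0"
proof
  assume *: "det2 x y = 0"
  have "zscale (fst y) x + zscale (- fst x) y = 0" "zscale (snd y) x + zscale (- snd x) y = 0"
    using * by (simp_all add: det2_def zscale_def prod_eq_iff mult.commute)
  note this[THEN lin_indepD[OF assms]]
  then have "x = 0" "y = 0" by (simp_all add: prod_eq_iff)
  then have "zscale 1 x + zscale 1 y = 0" by simp
  from lin_indepD[OF assms this] show False by simp
qed

text \<open>Triviality along closed walks makes \<open>s\<close> a coboundary: \<open>h v\<close> is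
  the product of the signs along a walk to \<open>v\<close> from a base vertex of its
  component.\<close>

lemma (in bidirected_digraph) ex_potential:
  fixes s :: "'b \<Rightarrow> int"
  assumes sign: "\<And>e. e \<in> arcs G \<Longrightarrow> s e \<in> {1, - 1}"
    and closed: "\<And>u p. awalk u p u \<Longrightarrow> prod_list (map s p) = 1"
  shows "\<exists>h. (\<forall>v\<in>verts G. h v \<in> {1, - 1}) \<and> (\<forall>e\<in>arcs G. h (head G e) = s e * h (tail G e))"
proof -
  have rev_walk: "\<exists>q. awalk v q u" if "awalk u p v" for u p v
    using that
  proof (induction p arbitrary: u)
    case Nil
    then show ?case by (metis awalk_Nil_iff)
  next
    case (Cons e p)
    then have e: "e \<in> arcs G" "u = tail G e" and "awalk (head G e) p v"
      by (simp_all add: awalk_Cons_iff)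
    then obtain q where "awalk v q (head G e)" using Cons.IH by blast
    moreover have "awalk (head G e) [arev e] u"
      using arc_implies_awalk[OF arev_in_arcs[OF e(1)]] e by simp
    ultimately show ?case using awalk_appendI by blast
  qed
  have prod_sign: "prod_list (map s p) \<in> {1, - 1}" if "set p \<subseteq> arcs G" for p
    using that
  proof (induction p)
    case (Cons e p)
    then have "s e \<in> {1, - 1}" "prod_list (map s p) \<in> {1, - 1}" using sign by auto
    then show ?case by auto
  qed simp
  define root where "root v = (SOME u. \<exists>p. awalk u p v)" for v
  define walk where "walk v = (SOME p. awalk (root v) p v)" for v
  have walk: "awalk (root v) (walk v) v" if "v \<in> verts G" for v
  proof -
    have "\<exists>u p. awalk u p v" using that by (metis awalk_Nil_iff)
    then have "\<exists>p. awalk (root v) p v" unfolding root_def by (rule someI_ex)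
    then show ?thesis unfolding walk_def by (rule someI_ex)
  qed
  define h where "h v = prod_list (map s (walk v))" for v
  have "h v \<in> {1, - 1}" if "v \<in> verts G" for v
    using prod_sign walk[OF that] unfolding h_def awalk_def by blast
  moreover have "h (head G e) = s e * h (tail G e)" if e: "e \<in> arcs G" for e
  proof -
    have fwd: "awalk (tail G e) [e] (head G e)" using arc_implies_awalk[OF e] .
    have bwd: "awalk (head G e) [arev e] (tail G e)"
      using arc_implies_awalk[OF arev_in_arcs[OF e]] e by simp
    \<comment> \<open>Arcs can be reversed, so both ends of \<open>e\<close> are reachable from the
      same vertices and \<open>SOME\<close> gives them the same root.\<close>
    have "(\<exists>p. awalk u p (tail G e)) \<longleftrightarrow> (\<exists>p. awalk u p (head G e))" for u
      using awalk_appendI fwd bwd by blast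
    then have root: "root (tail G e) = root (head G e)" unfolding root_def by simp
    have w: "awalk (root (head G e)) (walk (tail G e)) (tail G e)"
      "awalk (root (head G e)) (walk (head G e)) (head G e)"
      using walk[of "tail G e"] walk[of "head G e"] e root by simp_all
    \<comment> \<open>One walk \<open>q\<close> back to the root closes both the walk to
      \<open>head G e\<close> and the walk to \<open>tail G e\<close> prolonged by \<open>e\<close>;
      both products are 1, and the contribution of \<open>q\<close> cancels.\<close>
    obtain q where q: "awalk (head G e) q (root (head G e))" using rev_walk[OF w(2)] by blast
    have "h (head G e) * prod_list (map s q) = 1"
      using closed[OF awalk_appendI[OF w(2) q]] by (simp add: h_def)
    moreover have "s e * h (tail G e) * prod_list (map s q) = 1"
      using closed[OF awalk_appendI[OF w(1) awalk_appendI[OF fwd q]]] by (simp add: h_def ac_simps)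
    moreover have "prod_list (map s q) \<noteq> 0" using calculation(1) by auto
    ultimately show ?thesis by (metis mult_right_cancel)
  qed
  ultimately show ?thesis by (intro exI[of _ h]) blast
qed

section \<open>Independence of the Stiefel--Whitney class of local choices\<close>

locale T2_gkm_graph_3 = T2_gkm_graph G arev 3 \<alpha> for G arev \<alpha>
begin

section \<open>Labels and edges at a vertex of valence 3\<close>

lemma uedge_in_uedges: "e \<in> arcs G \<Longrightarrow> uedge arev e \<in> uedges G arev"
  by (simp add: uedges_def)

lemma uedge_arev [simp]: "uedge arev (arev e) = uedge arev e"
  by (auto simp: uedge_def)

lemma label_eq:
  assumes "e \<in> arcs G" "x \<in> \<alpha> (uedge arev e)"
  shows "\<alpha> (uedge arev e) = {x, - x}"
proof -
  obtain z where z: "\<alpha> (uedge arev e) = {z, - z}"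
    using label[OF uedge_in_uedges[OF assms(1)]] unfolding pm_labels_iff by blast
  then have "z = x \<or> z = - x" using assms(2) by auto
  then show ?thesis
  proof
    assume "z = x"
    with z show ?thesis by (simp only:)
  next
    assume "z = - x"
    with z have "\<alpha> (uedge arev e) = {- x, x}" by (simp only: minus_minus)
    then show ?thesis by (simp only: insert_commute[of "- x" x])
  qed
qed

lemma label_sign:
  assumes "e \<in> arcs G" "x \<in> \<alpha> (uedge arev e)" "y \<in> \<alpha> (uedge arev e)"
  obtains s where "s \<in> {1, - 1}" "y = zscale s x"
  using label_eq[OF assms(1,2)] assms(3) that[of 1] that[of "- 1"] by auto

lemma cong_labelE:
  assumes "cong_label x y (\<alpha> (uedge arev e))" "e \<in> arcs G" "z \<in> \<alpha> (uedge arev e)"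
  obtains k where "x - y = zscale k z"
proof -
  obtain c k where c: "c \<in> \<alpha> (uedge arev e)" and "x - y = zscale k c"
    using assms(1) unfolding cong_label_def by blast
  moreover obtain s where "c = zscale s z" using label_sign[OF assms(2,3) c] by blast
  ultimately have "x - y = zscale (k * s) z" by (simp add: zscale_zscale)
  then show thesis by (rule that)
qed

lemma out_arcs_tailE:
  assumes "e \<in> arcs G"
  obtains f g where "out_arcs G (tail G e) = {e, f, g}" "e \<noteq> f" "e \<noteq> g" "f \<noteq> g"
proof -
  have e: "e \<in> out_arcs G (tail G e)" using assms by simp
  have "card (out_arcs G (tail G e) - {e}) = 2"
    using valent[of "tail G e"] assms e by (simp add: card_Diff_singleton)
  then obtain f g where fg: "out_arcs G (tail G e) - {e} = {f, g}" "f \<noteq> g"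
    by (auto simp: card_2_iff)
  then have "out_arcs G (tail G e) = {e, f, g}" using e by blast
  moreover have "e \<noteq> f" "e \<noteq> g" using fg(1) by auto
  ultimately show thesis using that fg(2) by blast
qed

lemma connection_out_arcs_head:
  assumes "connection G arev nabla" "e \<in> arcs G"
    and "out_arcs G (tail G e) = {e, f, g}" "e \<noteq> f" "e \<noteq> g" "f \<noteq> g"
  shows "out_arcs G (head G e) = {arev e, nabla e f, nabla e g}"
    and "arev e \<noteq> nabla e f" "arev e \<noteq> nabla e g" "nabla e f \<noteq> nabla e g"
proof -
  have bij: "bij_betw (nabla e) {e, f, g} (out_arcs G (head G e))" and ne: "nabla e e = arev e"
    using assms unfolding connection_def by metis+
  show "out_arcs G (head G e) = {arev e, nabla e f, nabla e g}"
    using bij ne by (auto simp: bij_betw_def)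
  show "arev e \<noteq> nabla e f" "arev e \<noteq> nabla e g" "nabla e f \<noteq> nabla e g"
    using bij ne assms(4-6) unfolding bij_betw_def inj_on_def by (metis insertCI)+
qed

section \<open>The edge components of the Stiefel-Whitney class\<close>

lemma sw_label_nonzero:
  assumes sw: "sw_choice G arev \<alpha> e nabla b" and e: "e \<in> arcs G"
  shows "b e \<noteq> 0"
proof -
  obtain f g where out: "out_arcs G (tail G e) = {e, f, g}" "e \<noteq> f"
    using out_arcs_tailE[OF e] by metis
  have in_out: "e \<in> out_arcs G (tail G e)" "f \<in> out_arcs G (tail G e)"
    using out(1) e by auto
  have "b e \<in> \<alpha> (uedge arev e)" "b f \<in> \<alpha> (uedge arev f)"
    using sw in_out unfolding sw_choice_def by blast+
  then have "lin_indep (b f) (b e)"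
    using labels_indep[OF _ in_out(2,1)] out(2) e by auto
  then show ?thesis by (rule lin_indep_nonzero)
qed

text \<open>The lifts at the two ends are local, so that of \<open>arev e\<close> is known only up
  to the sign \<open>s\<close> relative to \<open>b e\<close>. The rest is
  \<open>product_difference_factor\<close> with the coefficients \<open>k\<close> and
  \<open>l\<close> of the transport.\<close>

lemma sw_product_difference:
  fixes b :: "'b \<Rightarrow> int \<times> int"
  assumes sw: "sw_choice G arev \<alpha> e nabla b" and e: "e \<in> arcs G"
    and out: "out_arcs G (tail G e) = {e, f, g}" "e \<noteq> f" "e \<noteq> g" "f \<noteq> g"
    and k: "b f - b (nabla e f) = zscale k (b e)" and l: "b g - b (nabla e g) = zscale l (b e)"
  defines "B \<equiv> lin (b e) :: int poly poly" and "X \<equiv> lin (b f)" and "Y \<equiv> lin (b g)"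
  obtains s where "s \<in> {1, - 1}"
    and "(\<Prod>l\<in>out_arcs G (tail G e). 1 + lin (b l)) -
        (\<Prod>l\<in>out_arcs G (head G e). 1 + lin (b l)) =
      B * ((1 + X) * (1 + Y) - of_int s * ((1 + (X - of_int k * B)) * (1 + (Y - of_int l * B)))
        + of_int k * (1 + Y) + of_int l * (1 + X) - of_int k * of_int l * B)"
proof -
  have conn: "connection G arev nabla"
    using sw by (simp add: sw_choice_def compatible_connection_def)
  note head = connection_out_arcs_head[OF conn e out]
  have in_out: "e \<in> out_arcs G (tail G e)" "arev e \<in> out_arcs G (head G e)"
    using e by auto
  have lab: "b e \<in> \<alpha> (uedge arev e)" "b (arev e) \<in> \<alpha> (uedge arev e)"
    using sw in_out unfolding sw_choice_def by (blast, metis UnI2 uedge_arev)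
  obtain s where s: "s \<in> {1, - 1}" "b (arev e) = zscale s (b e)"
    using label_sign[OF e lab] .
  have bf: "b (nabla e f) = b f - zscale k (b e)" "b (nabla e g) = b g - zscale l (b e)"
    using k l by (simp_all add: algebra_simps)
  show thesis
  proof
    show "s \<in> {1, - 1}" by (rule s(1))
  qed (unfold product_difference_factor[symmetric],
      use out(2-4) head(2-4) s(2) bf
      in \<open>simp add: out(1) head(1) lin_diff lin_zscale B_def X_def Y_def\<close>)
qed

lemma sw_product_difference_dvd:
  assumes sw: "sw_choice G arev \<alpha> e nabla b" and e: "e \<in> arcs G"
  shows "(lin (b e) :: int poly poly) dvd
    (\<Prod>l\<in>out_arcs G (tail G e). 1 + lin (b l)) - (\<Prod>l\<in>out_arcs G (head G e). 1 + lin (b l))"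
proof -
  obtain f g where out: "out_arcs G (tail G e) = {e, f, g}" "e \<noteq> f" "e \<noteq> g" "f \<noteq> g"
    using out_arcs_tailE[OF e] .
  have lab: "b e \<in> \<alpha> (uedge arev e)"
    using sw e unfolding sw_choice_def by simp
  have cong: "cong_label (b l) (b (nabla e l)) (\<alpha> (uedge arev e))" if "l \<in> {f, g}" for l
    using sw that out(1) unfolding sw_choice_def by blast
  obtain k where k: "b f - b (nabla e f) = zscale k (b e)"
    using cong_labelE[OF cong e lab] by blast
  obtain l where l: "b g - b (nabla e g) = zscale l (b e)"
    using cong_labelE[OF cong e lab] by blast
  show ?thesis by (rule sw_product_difference[OF sw e out k l]) simp
qed

text \<open>Since the label is even, \<open>lin (b e)\<close> reduces to 0 and the sign to 1. The
  two products in the quotient then cancel, and only the terms linear in \<open>k\<close> or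
  \<open>l\<close> survive.\<close>

lemma sw_edge_eq:
  assumes sw: "sw_choice G arev \<alpha> e nabla b" and e: "e \<in> arcs G"
    and even: "even (fst (b e))" "even (snd (b e))"
    and out: "out_arcs G (tail G e) = {e, f, g}" "e \<noteq> f" "e \<noteq> g" "f \<noteq> g"
    and k: "b f - b (nabla e f) = zscale k (b e)" and l: "b g - b (nabla e g) = zscale l (b e)"
  shows "sw_edge G e b = of_int k * (1 + lin (b g)) + of_int l * (1 + lin (b f))"
proof -
  have B0: "lin (b e) \<noteq> (0 :: int poly poly)"
    using sw_label_nonzero[OF sw e] by (simp add: lin_int_eq_0_iff)
  obtain s where s: "s \<in> {1, - 1}" and diff:
    "(\<Prod>l\<in>out_arcs G (tail G e). 1 + lin (b l)) -
      (\<Prod>l\<in>out_arcs G (head G e). 1 + lin (b l)) = (lin (b e) :: int poly poly) *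
      ((1 + lin (b f)) * (1 + lin (b g)) - of_int s *
        ((1 + (lin (b f) - of_int k * lin (b e))) * (1 + (lin (b g) - of_int l * lin (b e))))
        + of_int k * (1 + lin (b g)) + of_int l * (1 + lin (b f)) - of_int k * of_int l * lin (b e))"
    by (rule sw_product_difference[OF sw e out k l])
  have "(of_int s :: bit poly poly) = 1" using s by (auto simp: bit_poly_uminus)
  then show ?thesis
    unfolding sw_edge_def diff nonzero_mult_div_cancel_left[OF B0]
    by (simp add: red_diff red_add red_mult red_lin red_of_int red_1 lin_even_bit[OF even])
qed

text \<open>Along \<open>e\<close>, two connections either agree or exchange the targets of the two
  other edges. Reduced labels do not see signs, so by \<open>sw_edge_eq\<close> only parities of
  coefficients matter: each of them in the first case, their sum in the second.\<close>

lemma sw_edge_unique: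
  assumes b: "sw_choice G arev \<alpha> e nabla b" and c: "sw_choice G arev \<alpha> e nabla' c"
    and e: "e \<in> arcs G" and even: "uedge arev e \<in> even_edges G arev \<alpha>"
  shows "sw_edge G e b = sw_edge G e c"
proof -
  obtain f g where out: "out_arcs G (tail G e) = {e, f, g}" "e \<noteq> f" "e \<noteq> g" "f \<noteq> g"
    using out_arcs_tailE[OF e] .
  have conn: "connection G arev nabla" "connection G arev nabla'"
    using b c by (simp_all add: sw_choice_def compatible_connection_def)
  note head = connection_out_arcs_head[OF conn(1) e out]
  note head' = connection_out_arcs_head[OF conn(2) e out]
  have arcs: "f \<in> arcs G" "g \<in> arcs G" "nabla e f \<in> arcs G" "nabla e g \<in> arcs G"
    using out(1) head(1) by (blast intro: out_arcs_in_arcs)+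
  have lab: "x l \<in> \<alpha> (uedge arev l)"
    if "x = b \<or> x = c" "l \<in> {e, f, g, nabla e f, nabla e g}" for x l
    using b c that out(1) head(1) unfolding sw_choice_def by blast
  have sgn: "\<exists>s\<in>{1, - 1}. c l = zscale s (b l)"
    if l: "l \<in> {e, f, g, nabla e f, nabla e g}" for l
  proof -
    have "l \<in> arcs G" using l arcs e by blast
    from label_sign[OF this lab[OF _ l, of b] lab[OF _ l, of c]] show ?thesis by blast
  qed
  have ev: "even (fst (b e))" "even (snd (b e))" "even (fst (c e))" "even (snd (c e))"
    using even lab[of b e] lab[of c e] unfolding even_edges_def by auto
  have indep: "lin_indep (b f) (b e)" "lin_indep (b g) (b e)"
    using labels_indep[OF _ _ _ _ lab lab, of "tail G e"] out e by auto
  have cong: "cong_label (b l) (b (nabla e l)) (\<alpha> (uedge arev e))"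
    "cong_label (c l) (c (nabla' e l)) (\<alpha> (uedge arev e))" if "l \<in> {f, g}" for l
    using b c that out(1) unfolding sw_choice_def by blast+
  obtain k where k: "b f - b (nabla e f) = zscale k (b e)"
    using cong_labelE[OF cong(1) e lab[of b e]] by blast
  obtain l where l: "b g - b (nabla e g) = zscale l (b e)"
    using cong_labelE[OF cong(1) e lab[of b e]] by blast
  obtain m where m: "c f - c (nabla' e f) = zscale m (c e)"
    using cong_labelE[OF cong(2) e lab[of c e]] by blast
  obtain n where n: "c g - c (nabla' e g) = zscale n (c e)"
    using cong_labelE[OF cong(2) e lab[of c e]] by blast
  obtain r where r: "r \<in> {1, - 1}" "c e = zscale r (b e)" using sgn by blast
  obtain s where s: "s \<in> {1, - 1}" "c f = zscale s (b f)" using sgn by blast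
  obtain t where t: "t \<in> {1, - 1}" "c g = zscale t (b g)" using sgn by blast
  obtain s' where s': "s' \<in> {1, - 1}" "c (nabla e f) = zscale s' (b (nabla e f))"
    using sgn by blast
  obtain t' where t': "t' \<in> {1, - 1}" "c (nabla e g) = zscale t' (b (nabla e g))"
    using sgn by blast
  \<comment> \<open>Since \<open>c e = zscale r (b e)\<close>, the coefficients of the second choice
    become \<open>m * r\<close> and \<open>n * r\<close> relative to \<open>b e\<close>.\<close>
  have r_parity: "even (j * r) \<longleftrightarrow> even j" for j using r(1) by auto
  have lin_c: "lin (c f) = (lin (b f) :: bit poly poly)" "lin (c g) = (lin (b g) :: bit poly poly)"
    using s t by (auto simp: lin_uminus_bit)
  note eq_b = sw_edge_eq[OF b e ev(1,2) out k l]
  note eq_c = sw_edge_eq[OF c e ev(3,4) out m n, unfolded lin_c]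
  consider "nabla' e f = nabla e f" "nabla' e g = nabla e g"
    | "nabla' e f = nabla e g" "nabla' e g = nabla e f"
  proof -
    have "nabla' e f \<in> {arev e, nabla e f, nabla e g}" "nabla' e g \<in> {arev e, nabla e f, nabla e g}"
      unfolding head(1)[symmetric] head'(1) by simp_all
    then have "nabla' e f \<in> {nabla e f, nabla e g}" "nabla' e g \<in> {nabla e f, nabla e g}"
      using head'(2,3) by simp_all
    then show thesis using that head'(4) by auto
  qed
  then show ?thesis
  proof cases
    case 1
    have "even k \<longleftrightarrow> even (m * r)"
      using m by (intro parity_same[OF indep(1) s(1) s'(1) k]) (simp add: 1 s s' r zscale_zscale)
    moreover have "even l \<longleftrightarrow> even (n * r)"
      using n by (intro parity_same[OF indep(2) t(1) t'(1) l]) (simp add: 1 t t' r zscale_zscale)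
    ultimately show ?thesis unfolding eq_b eq_c of_int_bit_poly r_parity by simp
  next
    case 2
    have "even (k + l) \<longleftrightarrow> even (m * r + n * r)"
      using m n
      by (intro parity_swapped[OF indep(1) s(1) t(1) t'(1) s'(1) k l])
         (simp_all add: 2 s s' t t' r zscale_zscale)
    then have kl: "(of_int (k + l) :: bit poly poly) = of_int (m + n)"
      unfolding of_int_bit_poly using r_parity[of "m + n"] by (simp add: distrib_right)
    have be: "lin (b e) = (0 :: bit poly poly)" by (rule lin_even_bit[OF ev(1,2)])
    \<comment> \<open>The label of \<open>e\<close> vanishes mod 2, so transport preserves reduced
      labels. Going from \<open>g\<close> along \<open>nabla\<close> and back to \<open>f\<close>
      along \<open>nabla'\<close> shows that their reduced labels agree.\<close>
    have "lin (b g) = (lin (b (nabla e g)) :: bit poly poly)"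
      using arg_cong[OF l, of "lin :: _ \<Rightarrow> bit poly poly"] by (simp add: lin_diff lin_zscale be)
    also have "\<dots> = lin (c (nabla' e f))"
      using t' 2 by (auto simp: lin_uminus_bit)
    also have "\<dots> = lin (b f)"
      using arg_cong[OF m, of "lin :: _ \<Rightarrow> bit poly poly"] lin_even_bit[OF ev(3,4)]
      by (simp add: lin_diff lin_zscale lin_c)
    finally have "lin (b g) = (lin (b f) :: bit poly poly)" .
    then have "sw_edge G e b = of_int (k + l) * (1 + lin (b f))"
      "sw_edge G e c = of_int (m + n) * (1 + lin (b f))"
      using eq_b eq_c by (simp_all only: of_int_add distrib_right)
    then show ?thesis by (simp only: kl)
  qed
qed

section \<open>Consistent lifts\<close>

text \<open>Compatibility gives the congruence for some lifts, and adjusting signs gives it for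
  \<open>a\<close>. The sign is unique because it is the ratio of two nonzero determinants against
  the label of \<open>e\<close>; this justifies the \<open>THE\<close> in the definition.\<close>

lemma conn_sign:
  assumes comp: "compatible_connection G arev \<alpha> nabla" and a: "label_lift G arev \<alpha> a"
    and e: "e \<in> arcs G" and f: "f \<in> out_arcs G (tail G e)" and ef: "e \<noteq> f"
  shows "conn_sign arev \<alpha> nabla a e f \<in> {1, - 1}"
    and "cong_label (a (uedge arev f))
      (zscale (conn_sign arev \<alpha> nabla a e f) (a (uedge arev (nabla e f)))) (\<alpha> (uedge arev e))"
proof -
  let ?A = "\<alpha> (uedge arev e)" and ?x = "a (uedge arev f)" and ?y = "a (uedge arev (nabla e f))"
  let ?P = "\<lambda>s. s \<in> {1, - 1} \<and> cong_label ?x (zscale s ?y) ?A"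
  have fa: "f \<in> arcs G" using f by simp
  have "nabla e f \<in> out_arcs G (head G e)"
    using comp e f unfolding compatible_connection_def connection_def bij_betw_def by blast
  then have na: "nabla e f \<in> arcs G" by simp
  have lab: "a (uedge arev l) \<in> \<alpha> (uedge arev l)" if "l \<in> arcs G" for l
    using a uedge_in_uedges[OF that] unfolding label_lift_def by blast
  obtain x y where y: "y \<in> \<alpha> (uedge arev (nabla e f))" and x: "x \<in> \<alpha> (uedge arev f)"
    and yx: "cong_label y x ?A"
    using comp e f unfolding compatible_connection_def by blast
  obtain s where s: "s \<in> {1, - 1}" "?x = zscale s x" using label_sign[OF fa x lab[OF fa]] .
  obtain t where t: "t \<in> {1, - 1}" "y = zscale t ?y" using label_sign[OF na lab[OF na] y] .
  have xy: "cong_label x y ?A" using cong_label_sym[OF yx] .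
  have "cong_label (zscale s x) (zscale s y) ?A"
    using s(1) xy cong_label_minus[OF xy] by auto
  then have ex: "?P (s * t)" using s t by (auto simp: zscale_zscale)
  have "s1 = s2" if "?P s1" "?P s2" for s1 s2
  proof -
    obtain k1 where k1: "?x - zscale s1 ?y = zscale k1 (a (uedge arev e))"
      using cong_labelE[OF _ e lab[OF e]] \<open>?P s1\<close> by blast
    obtain k2 where k2: "?x - zscale s2 ?y = zscale k2 (a (uedge arev e))"
      using cong_labelE[OF _ e lab[OF e]] \<open>?P s2\<close> by blast
    have "s1 * det2 ?y (a (uedge arev e)) = s2 * det2 ?y (a (uedge arev e))"
      by (rule trans[OF det2_cong[OF k1, symmetric] det2_cong[OF k2]])
    moreover have "det2 ?x (a (uedge arev e)) \<noteq> 0"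
      using labels_indep[OF _ f _ _ lab[OF fa] lab[OF e]] e ef
      by (intro lin_indep_det2) auto
    ultimately show ?thesis using det2_cong[OF k1] by (metis mult_cancel_right mult_zero_right)
  qed
  then have "?P (conn_sign arev \<alpha> nabla a e f)"
    unfolding conn_sign_def using ex by (intro theI[of ?P])
  then show "conn_sign arev \<alpha> nabla a e f \<in> {1, - 1}"
    and "cong_label ?x (zscale (conn_sign arev \<alpha> nabla a e f) ?y) ?A" by auto
qed

section \<open>Corners of faces\<close>

definition flags :: "('b \<times> 'b) set" where
  "flags = {(e, f). e \<in> arcs G \<and> f \<in> arcs G \<and> tail G e = tail G f \<and> e \<noteq> f}"

text \<open>If \<open>f\<close> is normal to a face at a vertex, the two other edges there are
  tangent to it, so \<open>third e f\<close> continues the face past the corner.\<close>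

definition third :: "'b \<Rightarrow> 'b \<Rightarrow> 'b" where
  "third e f = (THE g. g \<in> out_arcs G (tail G e) - {e, f})"

lemma third_eqI:
  assumes "out_arcs G (tail G e) = {e, f, g}" "e \<noteq> g" "f \<noteq> g"
  shows "third e f = g"
  unfolding third_def assms(1) using assms(2,3) by (intro the_equality) auto

lemma out_arcs_third:
  assumes "(e, f) \<in> flags"
  shows "out_arcs G (tail G e) = {e, f, third e f}" "third e f \<noteq> e" "third e f \<noteq> f"
    "third e f \<in> arcs G" "tail G (third e f) = tail G e" "third (third e f) f = e"
proof -
  have e: "e \<in> arcs G" "e \<noteq> f" "f \<in> out_arcs G (tail G e)"
    using assms by (auto simp: flags_def)
  obtain p q where pq: "out_arcs G (tail G e) = {e, p, q}" "e \<noteq> p" "e \<noteq> q" "p \<noteq> q"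
    using out_arcs_tailE[OF e(1)] .
  then have "f = p \<or> f = q" using e(2,3) by simp
  then obtain g where g: "out_arcs G (tail G e) = {e, f, g}" "e \<noteq> g" "f \<noteq> g"
  proof
    assume "f = p"
    then show thesis using that[of q] pq by simp
  next
    assume "f = q"
    then show thesis using that[of p] pq by (simp add: insert_commute)
  qed
  note third = third_eqI[OF g]
  show out: "out_arcs G (tail G e) = {e, f, third e f}" "third e f \<noteq> e" "third e f \<noteq> f"
    using g third by auto
  have "third e f \<in> out_arcs G (tail G e)" using out(1) by blast
  then show arc: "third e f \<in> arcs G" "tail G (third e f) = tail G e" by auto
  show "third (third e f) f = e"
    using out e(2) unfolding arc(2)[symmetric] by (intro third_eqI) auto
qed

text \<open>A flag \<open>(e, f)\<close> is an edge \<open>e\<close> of a face together with its normal edge \<open>f\<close>; \<open>\<sigma>\<close> turns a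
  corner of the face and \<open>\<rho>\<close> moves along \<open>e\<close>. The wanted sign \<open>\<mu>\<close> is fixed by \<open>\<sigma>\<close> and multiplied
  by \<open>\<epsilon>\<close> under \<open>\<rho>\<close>. The orientation times the sign of the tangential determinant, \<open>d\<close>, differs
  from this by a factor \<open>-1\<close> under both involutions, which a 2-colouring of the flags repairs.\<close>

lemma ex_global_sw_choice:
  assumes "gkm_orientable G arev \<alpha>"
  shows "\<exists>nabla b. \<forall>e\<in>arcs G. sw_choice G arev \<alpha> e nabla b"
proof -
  obtain nabla a where comp: "compatible_connection G arev \<alpha> nabla"
    and a: "label_lift G arev \<alpha> a"
    and "\<forall>u p. awalk u p u \<longrightarrow> prod_list (map (edge_sign G arev \<alpha> nabla a) p) = 1"
    using assms unfolding gkm_orientable_def by (elim exE conjE)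
  note closed = this(3)[rule_format]
  define A where "A e = a (uedge arev e)" for e
  define \<epsilon> where "\<epsilon> e f = conn_sign arev \<alpha> nabla a e f" for e f
  have conn: "connection G arev nabla" using comp by (simp add: compatible_connection_def)
  have A: "A e \<in> \<alpha> (uedge arev e)" if "e \<in> arcs G" for e
    using a uedge_in_uedges[OF that] unfolding label_lift_def A_def by blast
  have \<epsilon>: "\<epsilon> e f \<in> {1, - 1}"
    "cong_label (A f) (zscale (\<epsilon> e f) (A (nabla e f))) (\<alpha> (uedge arev e))"
    if "(e, f) \<in> flags" for e f
    using conn_sign[OF comp a, of e f] that unfolding flags_def \<epsilon>_def A_def by auto
  have edge_sign: "edge_sign G arev \<alpha> nabla a e = - (\<epsilon> e f * \<epsilon> e (third e f))"
    if "(e, f) \<in> flags" for e f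
  proof -
    have "out_arcs G (tail G e) - {e} = {f, third e f}" "third e f \<noteq> f"
      using out_arcs_third[OF that] that by (auto simp: flags_def)
    then show ?thesis unfolding edge_sign_def \<epsilon>_def by simp
  qed
  have ex_flag: "\<exists>f. (e, f) \<in> flags" if e: "e \<in> arcs G" for e
  proof -
    obtain f g where "out_arcs G (tail G e) = {e, f, g}" "e \<noteq> f" using out_arcs_tailE[OF e] by metis
    then have "f \<in> out_arcs G (tail G e)" "e \<noteq> f" by blast+
    then show ?thesis using e by (auto simp: flags_def)
  qed
  have flag_third: "(e, third e f) \<in> flags" "(third e f, f) \<in> flags" if "(e, f) \<in> flags" for e f
    using out_arcs_third[OF that] that by (auto simp: flags_def)
  have sign: "edge_sign G arev \<alpha> nabla a e \<in> {1, - 1}" if e: "e \<in> arcs G" for e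
  proof -
    obtain f where f: "(e, f) \<in> flags" using ex_flag[OF e] by blast
    show ?thesis unfolding edge_sign[OF f] using \<epsilon>(1)[OF f] \<epsilon>(1)[OF flag_third(1)[OF f]] by auto
  qed
  \<comment> \<open>By orientability the edge signs form a coboundary; \<open>h\<close> is an
    orientation at every vertex, kept or reversed along \<open>e\<close> according to its edge
    sign.\<close>
  obtain h where "\<forall>v\<in>verts G. h v \<in> {1, - 1}"
    and "\<forall>e\<in>arcs G. h (head G e) = edge_sign G arev \<alpha> nabla a e * h (tail G e)"
  proof -
    have "\<exists>h. (\<forall>v\<in>verts G. h v \<in> {1, - 1}) \<and>
        (\<forall>e\<in>arcs G. h (head G e) = edge_sign G arev \<alpha> nabla a e * h (tail G e))"
      by (rule ex_potential) (fact sign, fact closed)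
    then show thesis using that by (elim exE conjE)
  qed
  note h = this[THEN bspec]

  \<comment> \<open>Involutions and 2-colouring of the flags\<close>
  define \<sigma> where "\<sigma> = (\<lambda>(e, f). (third e f, f))"
  define \<rho> where "\<rho> = (\<lambda>(e, f). (arev e, nabla e f))"
  have \<sigma>: "\<sigma> x \<in> flags \<and> \<sigma> (\<sigma> x) = x \<and> \<sigma> x \<noteq> x" if "x \<in> flags" for x
    using that flag_third out_arcs_third by (cases x) (simp add: \<sigma>_def)
  have transport: "(arev e, nabla e f) \<in> flags" "third (arev e) (nabla e f) = nabla e (third e f)"
    "nabla (arev e) (nabla e f) = f"
    if ef: "(e, f) \<in> flags" for e f
  proof -
    have e: "e \<in> arcs G" "e \<noteq> f" "f \<in> out_arcs G (tail G e)" using ef by (auto simp: flags_def)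
    note out = out_arcs_third(1-3)[OF ef]
    note head = connection_out_arcs_head[OF conn e(1) out(1) e(2) out(2,3)[symmetric]]
    have "nabla e f \<in> out_arcs G (head G e)" using head(1) by blast
    then show "(arev e, nabla e f) \<in> flags" using e(1) head(2) by (simp add: flags_def)
    show "third (arev e) (nabla e f) = nabla e (third e f)"
      using head e(1) by (intro third_eqI) simp_all
    show "nabla (arev e) (nabla e f) = f"
      using conn e unfolding connection_def by blast
  qed
  have \<rho>: "\<rho> x \<in> flags \<and> \<rho> (\<rho> x) = x \<and> \<rho> x \<noteq> x" if "x \<in> flags" for x
  proof (cases x)
    case (Pair e f)
    then have "arev e \<noteq> e" using that arev_neq by (simp add: flags_def)
    then show ?thesis using transport that Pair by (simp add: \<rho>_def)
  qed
  obtain c where "\<forall>x\<in>flags. c (\<sigma> x) = (\<not> c x) \<and> c (\<rho> x) = (\<not> c x)"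
  proof -
    have "\<exists>c. \<forall>x\<in>flags. c (\<sigma> x) = (\<not> c x) \<and> c (\<rho> x) = (\<not> c x)"
      by (rule two_involutions_colouring) (fact \<sigma>, fact \<rho>)
    then show thesis using that by (elim exE)
  qed
  note c = this[THEN bspec]

  \<comment> \<open>The signs on flags\<close>
  define d where "d e f = h (tail G e) * sgn (det2 (A (third e f)) (A e))" for e f
  define \<mu> where "\<mu> e f = (if c (e, f) then d e f else - d e f)" for e f
  have \<mu>_sign: "\<mu> e f \<in> {1, - 1}" if ef: "(e, f) \<in> flags" for e f
  proof -
    have e: "e \<in> arcs G" using ef by (simp add: flags_def)
    note t = out_arcs_third[OF ef]
    have "lin_indep (A (third e f)) (A e)"
      using labels_indep[OF _ _ _ t(2) A[OF t(4)] A[OF e], of "tail G e"] t(4,5) e by simp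
    then have "sgn (det2 (A (third e f)) (A e)) \<in> {1, - 1}"
      using lin_indep_det2 by (simp add: sgn_if)
    then show ?thesis using h(1)[of "tail G e"] e by (auto simp: \<mu>_def d_def)
  qed
  have \<mu>_third: "\<mu> (third e f) f = \<mu> e f" if ef: "(e, f) \<in> flags" for e f
  proof -
    note t = out_arcs_third[OF ef]
    \<comment> \<open>Turning the corner exchanges the two tangent labels and negates their
      determinant; the colour changes at the same time.\<close>
    have "d (third e f) f = - d e f"
      unfolding d_def t(5,6) det2_swap[of "A e"] by (simp add: sgn_minus)
    then show ?thesis using c[OF ef] by (simp add: \<mu>_def \<sigma>_def)
  qed
  have \<mu>_transport: "\<mu> (arev e) (nabla e f) = \<epsilon> e f * \<mu> e f" if ef: "(e, f) \<in> flags" for e f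
  proof -
    have e: "e \<in> arcs G" using ef by (simp add: flags_def)
    let ?g = "third e f"
    let ?D = "det2 (A (nabla e ?g)) (A e)"
    note \<epsilon>g = \<epsilon>[OF flag_third(1)[OF ef]]
    obtain k where "A ?g - zscale (\<epsilon> e ?g) (A (nabla e ?g)) = zscale k (A e)"
      using cong_labelE[OF \<epsilon>g(2) e A[OF e]] .
    then have "det2 (A ?g) (A e) = \<epsilon> e ?g * ?D" by (rule det2_cong)
    then have "sgn (det2 (A ?g) (A e)) = \<epsilon> e ?g * sgn ?D"
      using \<epsilon>g(1) by (auto simp: sgn_minus)
    moreover have "A (arev e) = A e" by (simp add: A_def)
    \<comment> \<open>\<open>h\<close> contributes
      \<open>- (\<epsilon> e f * \<epsilon> e ?g)\<close> and the determinant
      \<open>\<epsilon> e ?g\<close>. The tangential sign cancels; the normal sign remains, with a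
      minus that the colour absorbs.\<close>
    ultimately have "d (arev e) (nabla e f) = - (\<epsilon> e f * d e f)"
      unfolding d_def transport(2)[OF ef] using e h(2)[OF e] edge_sign[OF ef] \<epsilon>g(1) by auto
    then show ?thesis using c[OF ef] by (simp add: \<mu>_def \<rho>_def)
  qed

  \<comment> \<open>Two flags have the normal edge \<open>f\<close>, and \<open>\<mu>\<close> agrees
    on them by \<open>\<mu>_third\<close>, so the choice made by \<open>SOME\<close> is
    immaterial.\<close>
  define b where "b f = zscale (\<mu> (SOME e. (e, f) \<in> flags) f) (A f)" for f
  have b: "b f = zscale (\<mu> e f) (A f)" if ef: "(e, f) \<in> flags" for e f
  proof -
    let ?e = "SOME e. (e, f) \<in> flags"
    have "(?e, f) \<in> flags" using ef by (rule someI)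
    then have "?e \<in> out_arcs G (tail G e)" "?e \<noteq> f" using ef by (auto simp: flags_def)
    then have "?e = e \<or> ?e = third e f" using out_arcs_third(1)[OF ef] by blast
    then have "\<mu> ?e f = \<mu> e f" using \<mu>_third[OF ef] by metis
    then show ?thesis by (simp add: b_def)
  qed
  have b_label: "b f \<in> \<alpha> (uedge arev f)" if f: "f \<in> arcs G" for f
  proof -
    obtain e where "(f, e) \<in> flags" using ex_flag[OF f] by blast
    then have ef: "(e, f) \<in> flags" by (auto simp: flags_def)
    show ?thesis
      unfolding b[OF ef] label_eq[OF f A[OF f]] using \<mu>_sign[OF ef] by auto
  qed
  have "cong_label (b f) (b (nabla e f)) (\<alpha> (uedge arev e))"
    if e: "e \<in> arcs G" and f: "f \<in> out_arcs G (tail G e)" for e f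
  proof (cases "f = e")
    case True
    have "nabla e f = arev e" using conn e True unfolding connection_def by blast
    moreover have "b (arev e) \<in> \<alpha> (uedge arev e)"
      using b_label[OF arev_in_arcs[OF e]] by simp
    then obtain s where "b (arev e) = zscale s (b e)"
      using label_sign[OF e b_label[OF e]] by blast
    then have "b e - b (arev e) = zscale (1 - s) (b e)"
      by (simp add: zscale_def prod_eq_iff algebra_simps)
    ultimately show ?thesis using True b_label[OF e] unfolding cong_label_def by auto
  next
    case False
    then have ef: "(e, f) \<in> flags" using e f by (simp add: flags_def)
    obtain k where k: "A f - zscale (\<epsilon> e f) (A (nabla e f)) = zscale k (A e)"
      using cong_labelE[OF \<epsilon>(2)[OF ef] e A[OF e]] .
    \<comment> \<open>The factor \<open>\<epsilon> e f\<close> picked up by \<open>\<mu>\<close> is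
      the sign in the congruence for \<open>A\<close>, so the congruence for \<open>b\<close> is
      \<open>\<mu> e f\<close> times that for \<open>A\<close>.\<close>
    have "b (nabla e f) = zscale (\<epsilon> e f * \<mu> e f) (A (nabla e f))"
      using b[OF transport(1)[OF ef]] \<mu>_transport[OF ef] by simp
    then have "b f - b (nabla e f) =
        zscale (\<mu> e f) (A f - zscale (\<epsilon> e f) (A (nabla e f)))"
      unfolding b[OF ef] by (simp add: zscale_def prod_eq_iff algebra_simps)
    then have "b f - b (nabla e f) = zscale (\<mu> e f * k) (A e)"
      unfolding k by (simp add: zscale_zscale)
    then show ?thesis using A[OF e] unfolding cong_label_def by blast
  qed
  then have "sw_choice G arev \<alpha> e nabla b" if "e \<in> arcs G" for e
    using that b_label comp unfolding sw_choice_def by auto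
  then show ?thesis by blast
qed

end

section \<open>The preimage\<close>

text \<open>The division is exact, so a sign in the divisor passes to the quotient, where reduction
  mod 2 forgets it.\<close>

lemma red_div_sign:
  fixes d :: "int poly poly"
  assumes "d dvd p" "s \<in> {1, - 1}"
  shows "red (p div (of_int s * d)) = red (p div d)"
proof (cases "d = 0")
  case False
  from assms(1) obtain q where q: "p = d * q" by (rule dvdE)
  have "(- d) * (- q) div (- d) = - q"
    using False by (intro nonzero_mult_div_cancel_left) simp
  then have "p div (- d) = - q" unfolding q by (simp only: minus_mult_minus)
  then show ?thesis using assms(2) False q by (auto simp: red_uminus)
qed auto

theorem proposition5p3:
  fixes G :: "('a, 'b) pre_digraph"
    and arev :: "'b \<Rightarrow> 'b"
    and \<alpha> :: "'b set \<Rightarrow> (int \<times> int) set"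
    and ori :: "'b set \<Rightarrow> 'b"
    and a :: "'b set \<Rightarrow> int \<times> int"
    and nabla :: "'b set \<Rightarrow> 'b \<Rightarrow> 'b \<Rightarrow> 'b"
    and b :: "'b set \<Rightarrow> 'b \<Rightarrow> int \<times> int"
  assumes "T2_gkm_graph G arev 3 \<alpha>"
    and "gkm_orientable G arev \<alpha>"
    and "edge_orientation G arev ori"
    and "label_lift G arev \<alpha> a"
    and "\<And>\<epsilon>. \<epsilon> \<in> even_edges G arev \<alpha> \<Longrightarrow> sw_choice G arev \<alpha> (ori \<epsilon>) (nabla \<epsilon>) (b \<epsilon>)"
  shows "total_sw G arev \<alpha> ori a b \<in> Psi G arev \<alpha> ori a ` gkm_cohom G arev \<alpha>"
proof -
  interpret T2_gkm_graph_3 G arev \<alpha>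
    using assms(1) by (simp add: T2_gkm_graph_3_def)
  obtain nb c where sw: "\<And>e. e \<in> arcs G \<Longrightarrow> sw_choice G arev \<alpha> e nb c"
    using ex_global_sw_choice[OF assms(2)] by blast
  have c: "c e \<in> \<alpha> (uedge arev e)" if "e \<in> arcs G" for e
    using sw[OF that] that unfolding sw_choice_def by simp
  have a: "a (uedge arev e) \<in> \<alpha> (uedge arev e)" if "e \<in> arcs G" for e
    using assms(4) uedge_in_uedges[OF that] unfolding label_lift_def by blast
  \<comment> \<open>One system of lifts \<open>c\<close> serves all edges, so each vertex has a
    single product, and the divisibility holds along every edge.\<close>
  define F :: "'a \<Rightarrow> int poly poly" where
    "F = (\<lambda>v\<in>verts G. \<Prod>l\<in>out_arcs G v. 1 + lin (c l))"
  have F_diff: "F (tail G e) - F (head G e) =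
      (\<Prod>l\<in>out_arcs G (tail G e). 1 + lin (c l)) - (\<Prod>l\<in>out_arcs G (head G e). 1 + lin (c l))"
    if "e \<in> arcs G" for e
    using that by (simp add: F_def)
  have F_dvd: "lin (c e) dvd F (tail G e) - F (head G e)" if e: "e \<in> arcs G" for e
    unfolding F_diff[OF e] by (rule sw_product_difference_dvd[OF sw[OF e] e])
  have "F \<in> gkm_cohom G arev \<alpha>"
  proof -
    have "lin x dvd F (tail G e) - F (head G e)"
      if e: "e \<in> arcs G" and x: "x \<in> \<alpha> (uedge arev e)" for e x
      using F_dvd[OF e] x label_eq[OF e c[OF e]] by (auto simp: lin_uminus)
    then show ?thesis by (simp add: gkm_cohom_def F_def)
  qed
  moreover have "total_sw G arev \<alpha> ori a b = Psi G arev \<alpha> ori a F"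
  proof -
    have "(\<Prod>l\<in>out_arcs G v. 1 + red (lin (a (uedge arev l)))) = red (F v)" if "v \<in> verts G" for v
    proof -
      have "red (lin (a (uedge arev l))) = red (lin (c l))" if "l \<in> arcs G" for l
        using a[OF that] label_eq[OF that c[OF that]] by (auto simp: lin_uminus red_uminus)
      then show ?thesis
        using that by (simp add: F_def red_prod red_add red_1)
    qed
    moreover have "sw_edge G (ori \<epsilon>) (b \<epsilon>) =
        red ((F (tail G (ori \<epsilon>)) - F (head G (ori \<epsilon>))) div lin (a \<epsilon>))"
      if \<epsilon>: "\<epsilon> \<in> even_edges G arev \<alpha>" for \<epsilon>
    proof -
      let ?e = "ori \<epsilon>"
      have "\<epsilon> \<in> uedges G arev" using \<epsilon> by (simp add: even_edges_def)
      moreover from this have "?e \<in> \<epsilon>" using assms(3) by (simp add: edge_orientation_def)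
      ultimately have e: "?e \<in> arcs G" "uedge arev ?e = \<epsilon>"
        by (auto simp: uedges_def uedge_def)
      obtain s where s: "s \<in> {1, - 1}" "a \<epsilon> = zscale s (c ?e)"
        using label_sign[OF e(1) c[OF e(1)] a[OF e(1)]] e(2) by auto
      \<comment> \<open>The prescribed local lifts are exchanged for the global ones, for which the
        numerator is a difference of values of \<open>F\<close>.\<close>
      have "sw_edge G ?e (b \<epsilon>) = sw_edge G ?e c"
        using sw_edge_unique[OF assms(5)[OF \<epsilon>] sw[OF e(1)] e(1)] \<epsilon> e(2) by simp
      also have "\<dots> = red ((F (tail G ?e) - F (head G ?e)) div lin (c ?e))"
        by (simp add: sw_edge_def F_diff[OF e(1)])
      also have "\<dots> = red ((F (tail G ?e) - F (head G ?e)) div lin (a \<epsilon>))"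
        unfolding s(2) lin_zscale by (rule red_div_sign[OF F_dvd[OF e(1)] s(1), symmetric])
      finally show ?thesis .
    qed
    ultimately show ?thesis
      unfolding total_sw_def Psi_def by (simp cong: restrict_cong)
  qed
  ultimately show ?thesis by blast
qed

end
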